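(* Let $q>1$, let $W$ be a finite Coxeter group, and let $X$ be a Markov chain on $W$ given by left multiplication by an element of its Iwahori--Hecke algebra. Suppose that $X$ is reversible with respect to $\pi$. Then, for every integer $t\ge0$, $$\max_{x\in W}\left\|\frac{X_x^{t}}{\pi}-1\right\|_2^2=\left\|\frac{X_{\mathrm{id}}^{t}}{\pi}-1\right\|_2^2 .$$ In particular, any upper bound for the $\ell^2$ distance started from the identity holds uniformly over all starting states.
   Context: Let $s_1,\dots,s_r$ be the simple reflections of $W$ and $\ell$ its length function. The stationary measure is $\pi(w)=q^{\ell(w)}/\sum_{v\in W}q^{\ell(v)}$. The Iwahori--Hecke algebra $H$ of $W$ (with parameter $q$) is the complex algebra with basis $\{T_w\}_{w\in W}$ and multiplication determined by $T_{s_i}T_w=T_{s_iw}$ if $\ell(s_iw)>\ell(w)$ and $T_{s_i}T_w=(q-1)T_w+qT_{s_iw}$ if $\ell(s_iw)<\ell(w)$. Put $\widetilde T_w=q^{-\ell(w)}T_w$. That $X$ is given by left multiplication by an element $X\in H$ means that its transition probability $X(x,y)$ is the coefficient of $\widetilde T_y$ in $X\widetilde T_x$ (so this matrix is stochastic). Reversible means $\pi(x)X(x,y)=\pi(y)X(y,x)$ for all $x,y$. $X_x^t$ denotes the law after $t$ steps started at $x$, and $\left\|\frac{\mu}{\pi}-1\right\|_2^2=\sum_{y\in W}\pi(y)\left(\frac{\mu(y)}{\pi(y)}-1\right)^2$. *)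

theory Defs
  imports
    "HOL-Algebra.Generated_Groups"
    "HOL-Algebra.Module"
    "HOL-Algebra.Algebraic_Closure_Type"
    "HOL-Probability.Probability_Mass_Function"
begin

section \<open>Coxeter systems\<close>

text \<open>
  In a Coxeter matrix the entry \<open>0\<close> stands for infinity, that is, for the absence of a relation.
\<close>

definition coxeter_matrix :: "'w set \<Rightarrow> ('w \<Rightarrow> 'w \<Rightarrow> nat) \<Rightarrow> bool" where
  "coxeter_matrix S m \<longleftrightarrow>
     (\<forall>s\<in>S. \<forall>t\<in>S. m s t = m t s \<and> (m s t = 1 \<longleftrightarrow> s = t))"

text \<open>
  The congruence on words over \<open>S\<close> generated by the relations \<open>(s t)^(m s t) = 1\<close>. As \<open>m s s = 1\<close>,
  the words \<open>s s\<close> are among the relators, so no formal inverses of generators are needed and the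
  quotient of the words by this congruence is the group presented by \<open>(s t)^(m s t) = 1\<close>.
  An entry \<open>m s t = 0\<close> only yields the trivial relation.
\<close>

inductive coxeter_cong :: "'w set \<Rightarrow> ('w \<Rightarrow> 'w \<Rightarrow> nat) \<Rightarrow> 'w list \<Rightarrow> 'w list \<Rightarrow> bool"
  for S :: "'w set" and m :: "'w \<Rightarrow> 'w \<Rightarrow> nat" where
  refl: "u \<in> lists S \<Longrightarrow> coxeter_cong S m u u"
| sym: "coxeter_cong S m u v \<Longrightarrow> coxeter_cong S m v u"
| trans: "coxeter_cong S m u v \<Longrightarrow> coxeter_cong S m v w \<Longrightarrow> coxeter_cong S m u w"
| relator: "s \<in> S \<Longrightarrow> t \<in> S \<Longrightarrow> u \<in> lists S \<Longrightarrow> v \<in> lists S \<Longrightarrow>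
    coxeter_cong S m (u @ concat (replicate (m s t) [s, t]) @ v) (u @ v)"

definition word_prod :: "('w, 'b) monoid_scheme \<Rightarrow> 'w list \<Rightarrow> 'w" where
  "word_prod W ws = foldr (\<otimes>\<^bsub>W\<^esub>) ws \<one>\<^bsub>W\<^esub>"

text \<open>
  \<open>S\<close> is the set of simple reflections: it generates \<open>W\<close>, and \<open>W\<close> is presented by the relations
  of some Coxeter matrix on \<open>S\<close>.
\<close>

locale coxeter_system = group W for W :: "('w, 'b) monoid_scheme" (structure) +
  fixes S :: "'w set"
  assumes simple_subset: "S \<subseteq> carrier W"
    and generated: "generate W S = carrier W"
    and presented: "\<exists>m. coxeter_matrix S m \<and>
      (\<forall>u\<in>lists S. \<forall>v\<in>lists S. word_prod W u = word_prod W v \<longleftrightarrow> coxeter_cong S m u v)"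

definition cox_length :: "('w, 'b) monoid_scheme \<Rightarrow> 'w set \<Rightarrow> 'w \<Rightarrow> nat" where
  "cox_length W S w = (LEAST n. \<exists>ws\<in>lists S. length ws = n \<and> word_prod W ws = w)"

section \<open>The Iwahori--Hecke algebra\<close>

abbreviation complex_ring :: "complex ring" where
  "complex_ring \<equiv> ring_of_type_algebra"

text \<open>
  \<open>H\<close> is a unital associative complex algebra. \<open>T_one\<close> is the usual normalisation; it follows from
  the other axioms unless \<open>S\<close> is empty.
\<close>

locale iwahori_hecke_algebra =
  coxeter_system W S + H: ring H + module complex_ring H
  for W :: "('w, 'b) monoid_scheme" and S :: "'w set"
    and H :: "(complex, 'h) module" +
  fixes q :: real and T :: "'w \<Rightarrow> 'h"
  assumes smult_mult_left: "\<lbrakk>x \<in> carrier H; y \<in> carrier H\<rbrakk> \<Longrightarrow>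
      (a \<odot>\<^bsub>H\<^esub> x) \<otimes>\<^bsub>H\<^esub> y = a \<odot>\<^bsub>H\<^esub> (x \<otimes>\<^bsub>H\<^esub> y)"
    and smult_mult_right: "\<lbrakk>x \<in> carrier H; y \<in> carrier H\<rbrakk> \<Longrightarrow>
      x \<otimes>\<^bsub>H\<^esub> (a \<odot>\<^bsub>H\<^esub> y) = a \<odot>\<^bsub>H\<^esub> (x \<otimes>\<^bsub>H\<^esub> y)"
    and finite_W: "finite (carrier W)"
    and T_closed: "w \<in> carrier W \<Longrightarrow> T w \<in> carrier H"
    and T_basis: "h \<in> carrier H \<Longrightarrow>
      \<exists>!c. c \<in> carrier W \<rightarrow>\<^sub>E (UNIV :: complex set) \<and>
           h = (\<Oplus>\<^bsub>H\<^esub>w\<in>carrier W. c w \<odot>\<^bsub>H\<^esub> T w)"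
    and T_one: "T \<one>\<^bsub>W\<^esub> = \<one>\<^bsub>H\<^esub>"
    and T_mult_ascent: "\<lbrakk>s \<in> S; w \<in> carrier W;
        cox_length W S (s \<otimes>\<^bsub>W\<^esub> w) > cox_length W S w\<rbrakk> \<Longrightarrow>
      T s \<otimes>\<^bsub>H\<^esub> T w = T (s \<otimes>\<^bsub>W\<^esub> w)"
    and T_mult_descent: "\<lbrakk>s \<in> S; w \<in> carrier W;
        cox_length W S (s \<otimes>\<^bsub>W\<^esub> w) < cox_length W S w\<rbrakk> \<Longrightarrow>
      T s \<otimes>\<^bsub>H\<^esub> T w =
        complex_of_real (q - 1) \<odot>\<^bsub>H\<^esub> T w \<oplus>\<^bsub>H\<^esub> complex_of_real q \<odot>\<^bsub>H\<^esub> T (s \<otimes>\<^bsub>W\<^esub> w)"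

definition T_normalized ::
  "('w, 'b) monoid_scheme \<Rightarrow> 'w set \<Rightarrow> (complex, 'h) module \<Rightarrow> real \<Rightarrow> ('w \<Rightarrow> 'h) \<Rightarrow> 'w \<Rightarrow> 'h" where
  "T_normalized W S H q T w = complex_of_real (1 / q ^ cox_length W S w) \<odot>\<^bsub>H\<^esub> T w"

section \<open>Markov chains on a Coxeter group\<close>

text \<open>
  A Markov chain is given by its transition kernel \<open>K\<close>, with transition probabilities
  \<open>pmf (K x) y\<close>; the values of \<open>K\<close> outside the carrier are irrelevant.
\<close>

definition markov_chain_on :: "'w set \<Rightarrow> ('w \<Rightarrow> 'w pmf) \<Rightarrow> bool" where
  "markov_chain_on A K \<longleftrightarrow> (\<forall>x\<in>A. set_pmf (K x) \<subseteq> A)"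

definition law_after :: "('w \<Rightarrow> 'w pmf) \<Rightarrow> 'w \<Rightarrow> nat \<Rightarrow> 'w pmf" where
  "law_after K x t = ((\<lambda>\<nu>. bind_pmf \<nu> K) ^^ t) (return_pmf x)"

text \<open>
  The coefficients of \<open>h \<otimes> T_normalized x\<close> in the basis \<open>T_normalized\<close> are the transition
  probabilities out of \<open>x\<close>.
\<close>

definition given_by_left_mult ::
  "('w, 'b) monoid_scheme \<Rightarrow> 'w set \<Rightarrow> (complex, 'h) module \<Rightarrow> real \<Rightarrow> ('w \<Rightarrow> 'h) \<Rightarrow>
   ('w \<Rightarrow> 'w pmf) \<Rightarrow> 'h \<Rightarrow> bool" where
  "given_by_left_mult W S H q T K h \<longleftrightarrow>
     (\<forall>x\<in>carrier W. h \<otimes>\<^bsub>H\<^esub> T_normalized W S H q T x =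
        (\<Oplus>\<^bsub>H\<^esub>y\<in>carrier W. complex_of_real (pmf (K x) y) \<odot>\<^bsub>H\<^esub> T_normalized W S H q T y))"

definition stationary :: "('w, 'b) monoid_scheme \<Rightarrow> 'w set \<Rightarrow> real \<Rightarrow> 'w \<Rightarrow> real" where
  "stationary W S q w = q ^ cox_length W S w / (\<Sum>v\<in>carrier W. q ^ cox_length W S v)"

definition reversible_on :: "'w set \<Rightarrow> ('w \<Rightarrow> real) \<Rightarrow> ('w \<Rightarrow> 'w pmf) \<Rightarrow> bool" where
  "reversible_on A \<pi> K \<longleftrightarrow> (\<forall>x\<in>A. \<forall>y\<in>A. \<pi> x * pmf (K x) y = \<pi> y * pmf (K y) x)"

definition weighted_l2_norm :: "'w set \<Rightarrow> ('w \<Rightarrow> real) \<Rightarrow> ('w \<Rightarrow> real) \<Rightarrow> real" where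
  "weighted_l2_norm A \<pi> f = sqrt (\<Sum>y\<in>A. \<pi> y * (f y)\<^sup>2)"

definition l2_distance :: "('w, 'b) monoid_scheme \<Rightarrow> 'w set \<Rightarrow> real \<Rightarrow> 'w pmf \<Rightarrow> real" where
  "l2_distance W S q \<nu> =
     weighted_l2_norm (carrier W) (stationary W S q) (\<lambda>y. pmf \<nu> y / stationary W S q y - 1)"

end

theory Submission
  imports Defs
begin

text \<open>
  The chain acts by left multiplication, so by associativity it commutes with every right
  multiplication. Write \<open>M\<close> for right multiplication by the normalised generator of a simple
  reflection \<open>s\<close>. If the length increases from \<open>x\<close> to \<open>x s\<close>, then the normalised basis element of
  \<open>x s\<close> is \<open>M\<close> applied to that of \<open>x\<close>, so at every time the law started at \<open>x s\<close> is \<open>M\<close> applied to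
  the law started at \<open>x\<close> (lemma \<open>law_after_mult_simple\<close>).

  On coefficients, \<open>M\<close> is one step of a Metropolis chain (lemma \<open>comb_mult_simple\<close>): propose to go
  from \<open>w\<close> to \<open>w s\<close>, always accept if the length increases, and accept with probability \<open>1 / q\<close> if
  it decreases. This step has the measure proportional to \<open>q ^ len w\<close> as reversible measure, so it
  does not increase the weighted sum of squares (lemma \<open>metropolis_step_contraction\<close>), and hence not
  the distance of a law to stationarity either. Thus the distance at any fixed time does not
  increase from \<open>x\<close> to \<open>x s\<close>. Building a group element up from the identity along a
  reduced word shows that the identity is the worst starting state.

  The coefficients of \<open>M\<close> require the multiplication rules from the right, whereas the algebra is
  given by those from the left. They follow because a basis element is the product of the
  generators along a reduced word, together with the fact that multiplication by a simple
  reflection changes the length by exactly one, which comes from the sign character.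
\<close>

section \<open>Lengths in a Coxeter group\<close>

context coxeter_system
begin

abbreviation len :: "'w \<Rightarrow> nat" where
  "len \<equiv> cox_length W S"

lemma simple_closed [simp]: "s \<in> S \<Longrightarrow> s \<in> carrier W"
  using simple_subset by auto

lemma word_prod_Nil [simp]: "word_prod W [] = \<one>"
  by (simp add: word_prod_def)

lemma word_prod_Cons [simp]: "word_prod W (s # ws) = s \<otimes> word_prod W ws"
  by (simp add: word_prod_def)

lemma word_prod_closed [simp]: "ws \<in> lists S \<Longrightarrow> word_prod W ws \<in> carrier W"
  by (induction ws) auto

lemma word_prod_append:
  "u \<in> lists S \<Longrightarrow> v \<in> lists S \<Longrightarrow> word_prod W (u @ v) = word_prod W u \<otimes> word_prod W v"
  by (induction u) (auto simp: m_assoc)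

lemma simple_square:
  assumes "s \<in> S"
  shows "s \<otimes> s = \<one>"
proof -
  obtain m where m: "coxeter_matrix S m"
    "\<forall>u\<in>lists S. \<forall>v\<in>lists S. word_prod W u = word_prod W v \<longleftrightarrow> coxeter_cong S m u v"
    using presented by blast
  have "m s s = 1"
    using m(1) assms by (simp add: coxeter_matrix_def)
  then have "coxeter_cong S m [s, s] []"
    using coxeter_cong.relator[of s S s "[]" "[]" m] assms by simp
  moreover have "[s, s] \<in> lists S" "[] \<in> lists S"
    using assms by auto
  ultimately have "word_prod W [s, s] = word_prod W []"
    using m(2) by blast
  then show ?thesis
    using assms by simp
qed

lemma mult_simple_simple [simp]:
  "s \<in> S \<Longrightarrow> w \<in> carrier W \<Longrightarrow> w \<otimes> s \<otimes> s = w"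
  by (simp add: m_assoc simple_square)

text \<open>
  This is the sign character. A relator is \<open>m s t\<close> copies of a word of length two, so inserting or
  deleting it preserves the parity of the length.
\<close>

lemma coxeter_cong_parity:
  "coxeter_cong S m u v \<Longrightarrow> even (length u) \<longleftrightarrow> even (length v)"
  by (induction rule: coxeter_cong.induct)
    (auto simp: length_concat sum_list_replicate)

lemma word_prod_parity:
  assumes "u \<in> lists S" "v \<in> lists S" "word_prod W u = word_prod W v"
  shows "even (length u) \<longleftrightarrow> even (length v)"
proof -
  obtain m where "\<forall>u\<in>lists S. \<forall>v\<in>lists S. word_prod W u = word_prod W v \<longleftrightarrow> coxeter_cong S m u v"
    using presented by blast
  then have "coxeter_cong S m u v"
    using assms by blast
  then show ?thesis
    by (rule coxeter_cong_parity)
qed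

lemma word_exists:
  assumes "w \<in> carrier W"
  obtains ws where "ws \<in> lists S" "word_prod W ws = w"
proof -
  have "w \<in> generate W S"
    using assms generated by simp
  then have "\<exists>ws\<in>lists S. word_prod W ws = w"
  proof (induction rule: generate.induct)
    case one
    then show ?case by (intro bexI[of _ "[]"]) auto
  next
    case (incl s)
    then show ?case by (intro bexI[of _ "[s]"]) auto
  next
    case (inv s)
    then have "inv s = s"
      using simple_square by (intro inv_equality) auto
    then show ?case using inv by (intro bexI[of _ "[s]"]) auto
  next
    case (eng g h)
    then show ?case
      by (metis append_in_lists_conv word_prod_append)
  qed
  then show ?thesis using that by blast
qed

lemma reduced_word_exists:
  assumes "w \<in> carrier W"
  obtains ws where "ws \<in> lists S" "word_prod W ws = w" "length ws = len w"
proof -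
  have "\<exists>n. \<exists>ws\<in>lists S. length ws = n \<and> word_prod W ws = w"
    using word_exists[OF assms] by metis
  then have "\<exists>ws\<in>lists S. length ws = len w \<and> word_prod W ws = w"
    unfolding cox_length_def by (rule LeastI_ex)
  then show ?thesis using that by blast
qed

lemma len_word_prod_le: "ws \<in> lists S \<Longrightarrow> len (word_prod W ws) \<le> length ws"
  unfolding cox_length_def by (rule Least_le) auto

lemma len_parity:
  assumes "ws \<in> lists S"
  shows "even (len (word_prod W ws)) \<longleftrightarrow> even (length ws)"
proof -
  obtain us where "us \<in> lists S" "word_prod W us = word_prod W ws"
      "length us = len (word_prod W ws)"
    using reduced_word_exists word_prod_closed assms by blast
  then show ?thesis
    using word_prod_parity assms by metis
qed

lemma len_one [simp]: "len \<one> = 0"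
  using len_word_prod_le[of "[]"] by simp

lemma len_eq_0D: "w \<in> carrier W \<Longrightarrow> len w = 0 \<Longrightarrow> w = \<one>"
  by (metis reduced_word_exists length_0_conv word_prod_Nil)

lemma len_mult_simple_le:
  assumes "w \<in> carrier W" "s \<in> S"
  shows "len (w \<otimes> s) \<le> Suc (len w)"
proof -
  obtain ws where ws: "ws \<in> lists S" "word_prod W ws = w" "length ws = len w"
    using reduced_word_exists assms by blast
  then show ?thesis
    using len_word_prod_le[of "ws @ [s]"] assms by (simp add: word_prod_append)
qed

lemma len_simple_mult_le:
  assumes "w \<in> carrier W" "s \<in> S"
  shows "len (s \<otimes> w) \<le> Suc (len w)"
proof -
  obtain ws where ws: "ws \<in> lists S" "word_prod W ws = w" "length ws = len w"
    using reduced_word_exists assms by blast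
  then show ?thesis
    using len_word_prod_le[of "s # ws"] assms by simp
qed

lemma len_mult_simple_parity:
  assumes "w \<in> carrier W" "s \<in> S"
  shows "even (len (w \<otimes> s)) \<longleftrightarrow> odd (len w)"
proof -
  obtain ws where ws: "ws \<in> lists S" "word_prod W ws = w" "length ws = len w"
    using reduced_word_exists assms by blast
  then show ?thesis
    using len_parity[of "ws @ [s]"] assms by (simp add: word_prod_append)
qed

text \<open>
  Appending a letter to a reduced word, for \<open>w\<close> and for \<open>w s\<close>, bounds the change of length by one;
  parity excludes that the length stays the same.
\<close>

lemma len_mult_simple_cases:
  assumes "w \<in> carrier W" "s \<in> S"
  obtains (ascent) "len (w \<otimes> s) = Suc (len w)" | (descent) "len w = Suc (len (w \<otimes> s))"
proof -
  have "len w \<le> Suc (len (w \<otimes> s))"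
    using len_mult_simple_le[of "w \<otimes> s" s] assms by simp
  moreover have "len (w \<otimes> s) \<noteq> len w"
    using len_mult_simple_parity[OF assms] by metis
  ultimately show ?thesis
    using that len_mult_simple_le[OF assms] by linarith
qed

lemma len_simple [simp]: "s \<in> S \<Longrightarrow> len s = 1"
  using len_mult_simple_cases[of \<one> s] by auto

text \<open>
  Removing the first letter of a reduced word leaves a reduced word. Together with its mirror image
  below this gives induction on the length from either side: peeling off letters on the left is
  needed for the multiplication rules of the algebra, on the right for the walk from the identity.
\<close>

lemma left_descent_exists:
  assumes "w \<in> carrier W" "len w = Suc n"
  obtains r v where "r \<in> S" "v \<in> carrier W" "w = r \<otimes> v" "len v = n"
proof -
  obtain ws where ws: "ws \<in> lists S" "word_prod W ws = w" "length ws = len w"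
    using reduced_word_exists assms by blast
  then obtain r us where us: "ws = r # us" "r \<in> S" "us \<in> lists S" "length us = n"
    using assms by (cases ws) auto
  have "len (word_prod W us) \<le> n"
    using len_word_prod_le us by metis
  moreover have "Suc n \<le> Suc (len (word_prod W us))"
    using len_simple_mult_le[of "word_prod W us" r] us ws assms by simp
  ultimately show ?thesis
    using that[of r "word_prod W us"] us ws by simp
qed

lemma right_descent_exists:
  assumes "w \<in> carrier W" "len w = Suc n"
  obtains s v where "s \<in> S" "v \<in> carrier W" "w = v \<otimes> s" "len v = n"
proof -
  obtain ws where ws: "ws \<in> lists S" "word_prod W ws = w" "length ws = len w"
    using reduced_word_exists assms by blast
  then obtain s us where us: "ws = us @ [s]" "s \<in> S" "us \<in> lists S" "length us = n"
    using assms by (cases ws rule: rev_cases) auto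
  have "len (word_prod W us) \<le> n"
    using len_word_prod_le us by metis
  moreover have "Suc n \<le> Suc (len (word_prod W us))"
    using len_mult_simple_le[of "word_prod W us" s] us ws assms by (simp add: word_prod_append)
  ultimately show ?thesis
    using that[of s "word_prod W us"] us ws by (simp add: word_prod_append)
qed

lemma bij_betw_mult_simple:
  assumes "s \<in> S"
  shows "bij_betw (\<lambda>w. w \<otimes> s) (carrier W) (carrier W)"
  by (rule bij_betwI[where g = "\<lambda>w. w \<otimes> s"]) (use assms in auto)

section \<open>The Metropolis step of a simple reflection\<close>

text \<open>
  The mass at \<open>y\<close> after one step from the mass distribution \<open>c\<close>: the accepted proposals from \<open>y s\<close>
  and the rejected ones at \<open>y\<close>. From the shorter to the longer element nothing is rejected, so the
  second contribution occurs only where \<open>y\<close> is the longer one.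
\<close>

definition metropolis_step :: "real \<Rightarrow> 'w \<Rightarrow> ('w \<Rightarrow> real) \<Rightarrow> 'w \<Rightarrow> real" where
  "metropolis_step q s c y =
     (if len y < len (y \<otimes> s) then c (y \<otimes> s) / q else c (y \<otimes> s) + (1 - 1 / q) * c y)"

text \<open>
  This is the square of the norm on the Hecke algebra for which the \<open>T w\<close> are orthogonal with
  squared norm \<open>q ^ len w\<close>, evaluated at the element with coefficients \<open>c\<close> in the normalised basis.
\<close>

definition weighted_square_sum :: "real \<Rightarrow> ('w \<Rightarrow> real) \<Rightarrow> real" where
  "weighted_square_sum q c = (\<Sum>y\<in>carrier W. (c y)\<^sup>2 / q ^ len y)"

text \<open>
  The step preserves each left coset of the subgroup generated by \<open>s\<close>, so the inequality may be checked
  on the pairs \<open>y\<close>, \<open>y s\<close> with \<open>y\<close> the shorter element. There the loss is a multiple of \<open>(c y - c (y s) / q)\<close> squared, which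
  measures how far the densities with respect to \<open>q ^ len y\<close> differ on the pair.
\<close>

lemma metropolis_step_contraction:
  assumes q: "q > 1" and s: "s \<in> S"
  shows "weighted_square_sum q (metropolis_step q s c) \<le> weighted_square_sum q c"
proof -
  define F where "F y = ((c y)\<^sup>2 - (metropolis_step q s c y)\<^sup>2) / q ^ len y" for y
  have ascent: "F y + F (y \<otimes> s) \<ge> 0"
    if y: "y \<in> carrier W" "len (y \<otimes> s) = Suc (len y)" for y
  proof -
    let ?a = "c y" and ?b = "c (y \<otimes> s)"
    have M1: "metropolis_step q s c y = ?b / q"
      using y by (simp add: metropolis_step_def)
    have M2: "metropolis_step q s c (y \<otimes> s) = ?a + (1 - 1 / q) * ?b"
      using y s by (simp add: metropolis_step_def)
    have "F y + F (y \<otimes> s) =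
        ((?a\<^sup>2 - (?b / q)\<^sup>2) + (?b\<^sup>2 - (?a + (1 - 1 / q) * ?b)\<^sup>2) / q) / q ^ len y"
      unfolding F_def M1 M2 y(2) using q by (simp add: field_simps)
    also have "(?a\<^sup>2 - (?b / q)\<^sup>2) + (?b\<^sup>2 - (?a + (1 - 1 / q) * ?b)\<^sup>2) / q
        = (1 - 1 / q) * (?a - ?b / q)\<^sup>2"
      using q by (simp add: field_simps power2_eq_square)
    finally show ?thesis
      using q by simp
  qed
  have pair: "F y + F (y \<otimes> s) \<ge> 0" if y: "y \<in> carrier W" for y
    using y s
  proof (cases rule: len_mult_simple_cases)
    case descent
    then show ?thesis
      using ascent[of "y \<otimes> s"] y s by simp
  qed (use ascent y in auto)
  \<comment> \<open>Each pair is counted twice, once from either of its elements.\<close>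
  have "(\<Sum>y\<in>carrier W. F (y \<otimes> s)) = (\<Sum>y\<in>carrier W. F y)"
    by (rule sum.reindex_bij_betw[OF bij_betw_mult_simple[OF s]])
  then have "2 * (\<Sum>y\<in>carrier W. F y) = (\<Sum>y\<in>carrier W. F y + F (y \<otimes> s))"
    by (simp add: sum.distrib)
  also have "\<dots> \<ge> 0"
    using pair by (rule sum_nonneg)
  finally have "(\<Sum>y\<in>carrier W. F y) \<ge> 0"
    by simp
  then show ?thesis
    by (simp add: F_def weighted_square_sum_def diff_divide_distrib sum_subtractf)
qed

text \<open>
  Expanding the square, the cross term is the total mass of the law and the constant term that of
  the stationary measure; both are one. Comparing distances to stationarity thus amounts to
  comparing weighted sums of squares.
\<close>

lemma l2_distance_square:
  assumes fin: "finite (carrier W)" and q: "q > 0" and supp: "set_pmf \<nu> \<subseteq> carrier W"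
  shows "(l2_distance W S q \<nu>)\<^sup>2 =
    (\<Sum>v\<in>carrier W. q ^ len v) * weighted_square_sum q (pmf \<nu>) - 1"
proof -
  define Z where "Z = (\<Sum>v\<in>carrier W. q ^ len v)"
  let ?p = "\<lambda>w. q ^ len w / Z"
  have st: "stationary W S q = ?p"
    by (simp add: stationary_def Z_def fun_eq_iff)
  have Z: "Z > 0"
    unfolding Z_def using fin q by (intro sum_pos) auto
  have mass: "(\<Sum>y\<in>carrier W. pmf \<nu> y) = 1"
    using fin supp by (rule sum_pmf_eq_1)
  have "(l2_distance W S q \<nu>)\<^sup>2 = (\<Sum>y\<in>carrier W. ?p y * (pmf \<nu> y / ?p y - 1)\<^sup>2)"
    unfolding l2_distance_def weighted_l2_norm_def st
    using Z q by (intro real_sqrt_pow2 sum_nonneg) auto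
  also have "\<dots> = (\<Sum>y\<in>carrier W. Z * ((pmf \<nu> y)\<^sup>2 / q ^ len y) - 2 * pmf \<nu> y + ?p y)"
  proof (rule sum.cong [OF HOL.refl])
    fix y
    have "p * (a / p - 1)\<^sup>2 = a\<^sup>2 / p - 2 * a + p" if "p > 0" for a p :: real
      using that by (simp add: field_simps power2_eq_square)
    from this [of "?p y" "pmf \<nu> y"] Z q
    show "?p y * (pmf \<nu> y / ?p y - 1)\<^sup>2 = Z * ((pmf \<nu> y)\<^sup>2 / q ^ len y) - 2 * pmf \<nu> y + ?p y"
      by simp
  qed
  also have "\<dots> = Z * weighted_square_sum q (pmf \<nu>) - 2 * (\<Sum>y\<in>carrier W. pmf \<nu> y)
      + (\<Sum>y\<in>carrier W. ?p y)"
    by (simp add: sum.distrib sum_subtractf sum_distrib_left weighted_square_sum_def)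
  also have "(\<Sum>y\<in>carrier W. ?p y) = 1"
    using Z by (simp add: Z_def sum_divide_distrib [symmetric])
  finally show ?thesis
    by (simp add: mass Z_def)
qed

end

section \<open>Right multiplication in the Hecke algebra\<close>

context iwahori_hecke_algebra
begin

lemma H_smult_closed [simp]: "x \<in> carrier H \<Longrightarrow> a \<odot>\<^bsub>H\<^esub> x \<in> carrier H"
  using smult_closed[of a x] by (simp add: ring_of_type_algebra_def)

lemma H_smult_add: "x \<in> carrier H \<Longrightarrow> (a + b) \<odot>\<^bsub>H\<^esub> x = a \<odot>\<^bsub>H\<^esub> x \<oplus>\<^bsub>H\<^esub> b \<odot>\<^bsub>H\<^esub> x"
  using smult_l_distr[of a b x] by (simp add: ring_of_type_algebra_def)

lemma H_smult_distrib:
  "x \<in> carrier H \<Longrightarrow> y \<in> carrier H \<Longrightarrow> a \<odot>\<^bsub>H\<^esub> (x \<oplus>\<^bsub>H\<^esub> y) = a \<odot>\<^bsub>H\<^esub> x \<oplus>\<^bsub>H\<^esub> a \<odot>\<^bsub>H\<^esub> y"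
  using smult_r_distr[of a x y] by (simp add: ring_of_type_algebra_def)

lemma H_smult_smult: "x \<in> carrier H \<Longrightarrow> a \<odot>\<^bsub>H\<^esub> (b \<odot>\<^bsub>H\<^esub> x) = (a * b) \<odot>\<^bsub>H\<^esub> x"
  using smult_assoc1[of a b x] by (simp add: ring_of_type_algebra_def)

lemma H_smult_one [simp]: "x \<in> carrier H \<Longrightarrow> 1 \<odot>\<^bsub>H\<^esub> x = x"
  using smult_one[of x] by (simp add: ring_of_type_algebra_def)

lemma H_smult_zero [simp]: "x \<in> carrier H \<Longrightarrow> 0 \<odot>\<^bsub>H\<^esub> x = \<zero>\<^bsub>H\<^esub>"
  using smult_l_null[of x] by (simp add: ring_of_type_algebra_def)

declare T_closed [simp]

text \<open>
  Write \<open>w = r v\<close> with \<open>v\<close> shorter by one. Then \<open>v s\<close> is longer than \<open>v\<close> and \<open>r (v s)\<close> is longer than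
  \<open>v s\<close>, since otherwise \<open>w s\<close> could not be longer than \<open>w\<close> by one. So the left ascent rule for
  \<open>r\<close> may be applied before and after the induction hypothesis for \<open>v\<close>.
\<close>

lemma T_mult_ascent_right:
  assumes "w \<in> carrier W" "s \<in> S" "len (w \<otimes>\<^bsub>W\<^esub> s) = Suc (len w)"
  shows "T w \<otimes>\<^bsub>H\<^esub> T s = T (w \<otimes>\<^bsub>W\<^esub> s)"
  using assms
proof (induction "len w" arbitrary: w)
  case 0
  then have "w = \<one>\<^bsub>W\<^esub>"
    by (simp add: len_eq_0D)
  then show ?case
    using 0 by (simp add: T_one)
next
  case (Suc n)
  obtain r v where rv: "r \<in> S" "v \<in> carrier W" "w = r \<otimes>\<^bsub>W\<^esub> v" "len v = n"
    using left_descent_exists Suc by metis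
  have rvs: "w \<otimes>\<^bsub>W\<^esub> s = r \<otimes>\<^bsub>W\<^esub> (v \<otimes>\<^bsub>W\<^esub> s)"
    using rv Suc by (simp add: group.is_monoid monoid.m_assoc)
  have len_vs: "len (v \<otimes>\<^bsub>W\<^esub> s) = Suc n"
    using len_mult_simple_le[of v s] len_simple_mult_le[of "v \<otimes>\<^bsub>W\<^esub> s" r] rv Suc rvs by simp
  have "T w \<otimes>\<^bsub>H\<^esub> T s = T r \<otimes>\<^bsub>H\<^esub> T v \<otimes>\<^bsub>H\<^esub> T s"
    using T_mult_ascent[of r v] rv Suc by simp
  also have "\<dots> = T r \<otimes>\<^bsub>H\<^esub> (T v \<otimes>\<^bsub>H\<^esub> T s)"
    using rv Suc by (intro H.m_assoc) auto
  also have "T v \<otimes>\<^bsub>H\<^esub> T s = T (v \<otimes>\<^bsub>W\<^esub> s)"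
    using Suc rv len_vs by simp
  also have "T r \<otimes>\<^bsub>H\<^esub> T (v \<otimes>\<^bsub>W\<^esub> s) = T (w \<otimes>\<^bsub>W\<^esub> s)"
    using T_mult_ascent[of r "v \<otimes>\<^bsub>W\<^esub> s"] rv Suc len_vs rvs by simp
  finally show ?case .
qed

text \<open>
  With \<open>v = w s\<close> the ascent rule gives \<open>T w = T v T s\<close>, and the claim reduces to the quadratic
  relation for \<open>T s\<close>, which is the left descent rule at \<open>w = s\<close>.
\<close>

lemma T_mult_descent_right:
  assumes w: "w \<in> carrier W" and s: "s \<in> S" and "len w = Suc (len (w \<otimes>\<^bsub>W\<^esub> s))"
  shows "T w \<otimes>\<^bsub>H\<^esub> T s =
    complex_of_real (q - 1) \<odot>\<^bsub>H\<^esub> T w \<oplus>\<^bsub>H\<^esub> complex_of_real q \<odot>\<^bsub>H\<^esub> T (w \<otimes>\<^bsub>W\<^esub> s)"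
proof -
  let ?v = "w \<otimes>\<^bsub>W\<^esub> s"
  have v: "?v \<in> carrier W"
    using w s by simp
  have vs: "T ?v \<otimes>\<^bsub>H\<^esub> T s = T w"
    using T_mult_ascent_right[of ?v s] assms by simp
  have quadratic: "T s \<otimes>\<^bsub>H\<^esub> T s =
      complex_of_real (q - 1) \<odot>\<^bsub>H\<^esub> T s \<oplus>\<^bsub>H\<^esub> complex_of_real q \<odot>\<^bsub>H\<^esub> \<one>\<^bsub>H\<^esub>"
    using T_mult_descent[of s s] s by (simp add: simple_square T_one)
  have "T w \<otimes>\<^bsub>H\<^esub> T s = T ?v \<otimes>\<^bsub>H\<^esub> (T s \<otimes>\<^bsub>H\<^esub> T s)"
    using vs v s by (simp add: H.m_assoc [symmetric])
  also have "\<dots> = complex_of_real (q - 1) \<odot>\<^bsub>H\<^esub> (T ?v \<otimes>\<^bsub>H\<^esub> T s)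
      \<oplus>\<^bsub>H\<^esub> complex_of_real q \<odot>\<^bsub>H\<^esub> T ?v"
    unfolding quadratic using v s by (simp add: H.r_distr smult_mult_right)
  finally show ?thesis
    unfolding vs .
qed

abbreviation Tn :: "'w \<Rightarrow> 'h" where
  "Tn \<equiv> T_normalized W S H q T"

lemma Tn_closed [simp]: "w \<in> carrier W \<Longrightarrow> Tn w \<in> carrier H"
  by (simp add: T_normalized_def)

lemma Tn_mult_ascent:
  assumes "w \<in> carrier W" "s \<in> S" "len (w \<otimes>\<^bsub>W\<^esub> s) = Suc (len w)"
  shows "Tn w \<otimes>\<^bsub>H\<^esub> Tn s = Tn (w \<otimes>\<^bsub>W\<^esub> s)"
  using assms
  by (simp add: T_normalized_def smult_mult_left smult_mult_right H_smult_smult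
      T_mult_ascent_right mult.commute)

lemma Tn_mult_descent:
  assumes "w \<in> carrier W" "s \<in> S" "len w = Suc (len (w \<otimes>\<^bsub>W\<^esub> s))" "q \<noteq> 0"
  shows "Tn w \<otimes>\<^bsub>H\<^esub> Tn s =
    complex_of_real (1 / q) \<odot>\<^bsub>H\<^esub> Tn (w \<otimes>\<^bsub>W\<^esub> s) \<oplus>\<^bsub>H\<^esub> complex_of_real (1 - 1 / q) \<odot>\<^bsub>H\<^esub> Tn w"
proof -
  let ?l = "len (w \<otimes>\<^bsub>W\<^esub> s)"
  have coeff: "(1 / q ^ Suc ?l) * (1 / q) * (q - 1) = (1 - 1 / q) * (1 / q ^ Suc ?l)"
    "(1 / q ^ Suc ?l) * (1 / q) * q = (1 / q) * (1 / q ^ ?l)"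
    using assms(4) by (simp_all add: field_simps)
  have "Tn w \<otimes>\<^bsub>H\<^esub> Tn s = complex_of_real ((1 / q ^ Suc ?l) * (1 / q)) \<odot>\<^bsub>H\<^esub> (T w \<otimes>\<^bsub>H\<^esub> T s)"
    using assms by (simp add: T_normalized_def smult_mult_left smult_mult_right H_smult_smult mult_ac)
  also have "\<dots> = complex_of_real ((1 / q ^ Suc ?l) * (1 / q) * (q - 1)) \<odot>\<^bsub>H\<^esub> T w
      \<oplus>\<^bsub>H\<^esub> complex_of_real ((1 / q ^ Suc ?l) * (1 / q) * q) \<odot>\<^bsub>H\<^esub> T (w \<otimes>\<^bsub>W\<^esub> s)"
    unfolding T_mult_descent_right[OF assms(1-3)] of_real_mult
    using assms(1,2) by (simp add: H_smult_distrib H_smult_smult del: of_real_diff)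
  also have "\<dots> = complex_of_real (1 - 1 / q) \<odot>\<^bsub>H\<^esub> Tn w
      \<oplus>\<^bsub>H\<^esub> complex_of_real (1 / q) \<odot>\<^bsub>H\<^esub> Tn (w \<otimes>\<^bsub>W\<^esub> s)"
    unfolding T_normalized_def coeff of_real_mult
    using assms by (simp add: H_smult_smult)
  finally show ?thesis
    using assms by (simp add: H.a_comm)
qed

text \<open>
  Real coordinate vectors are embedded in the algebra through the normalised basis, so that a law on
  the group becomes an element of the algebra.
\<close>

definition comb :: "('w \<Rightarrow> real) \<Rightarrow> 'h" where
  "comb c = (\<Oplus>\<^bsub>H\<^esub>w\<in>carrier W. complex_of_real (c w) \<odot>\<^bsub>H\<^esub> Tn w)"

lemma comb_closed [simp]: "comb c \<in> carrier H"
  unfolding comb_def by (intro H.finsum_closed) auto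

lemma comb_cong: "(\<And>w. w \<in> carrier W \<Longrightarrow> c w = d w) \<Longrightarrow> comb c = comb d"
  unfolding comb_def by (intro H.finsum_cong') auto

lemma comb_zero: "comb (\<lambda>_. 0) = \<zero>\<^bsub>H\<^esub>"
proof -
  have "comb (\<lambda>_. 0) = (\<Oplus>\<^bsub>H\<^esub>w\<in>carrier W. \<zero>\<^bsub>H\<^esub>)"
    unfolding comb_def by (intro H.finsum_cong') auto
  then show ?thesis by (simp add: H.finsum_zero)
qed

lemma comb_add: "comb (\<lambda>w. c w + d w) = comb c \<oplus>\<^bsub>H\<^esub> comb d"
proof -
  have "comb (\<lambda>w. c w + d w) = (\<Oplus>\<^bsub>H\<^esub>w\<in>carrier W.
      complex_of_real (c w) \<odot>\<^bsub>H\<^esub> Tn w \<oplus>\<^bsub>H\<^esub> complex_of_real (d w) \<odot>\<^bsub>H\<^esub> Tn w)"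
    unfolding comb_def by (intro H.finsum_cong') (auto simp: H_smult_add)
  then show ?thesis
    unfolding comb_def by (subst H.finsum_addf [symmetric]) auto
qed

lemma comb_scale: "comb (\<lambda>w. a * c w) = complex_of_real a \<odot>\<^bsub>H\<^esub> comb c"
proof -
  have "complex_of_real a \<odot>\<^bsub>H\<^esub> comb c =
      (\<Oplus>\<^bsub>H\<^esub>w\<in>carrier W. complex_of_real a \<odot>\<^bsub>H\<^esub> (complex_of_real (c w) \<odot>\<^bsub>H\<^esub> Tn w))"
    unfolding comb_def
    by (intro finsum_smult_ldistr finite_W) (auto simp: ring_of_type_algebra_def)
  also have "\<dots> = comb (\<lambda>w. a * c w)"
    unfolding comb_def by (intro H.finsum_cong') (auto simp: H_smult_smult)
  finally show ?thesis by simp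
qed

lemma comb_sum:
  assumes "finite I"
  shows "comb (\<lambda>w. \<Sum>i\<in>I. c i w) = (\<Oplus>\<^bsub>H\<^esub>i\<in>I. comb (c i))"
  using assms by (induction I rule: finite_induct) (auto simp: comb_zero comb_add)

text \<open>
  Passing from \<open>T\<close> to the normalised basis divides the coordinates by \<open>q ^ len w\<close>, which is
  invertible, so uniqueness of coordinates carries over.
\<close>

lemma comb_inj:
  assumes "q \<noteq> 0" and eq: "comb c = comb d" and w: "w \<in> carrier W"
  shows "c w = d w"
proof -
  \<comment> \<open>The coordinates in the basis \<open>T\<close>, made extensional because uniqueness is stated for such functions.\<close>
  define e where "e c = (\<lambda>w\<in>carrier W. complex_of_real (c w / q ^ len w))" for c :: "'w \<Rightarrow> real"
  have e: "comb c = (\<Oplus>\<^bsub>H\<^esub>w\<in>carrier W. e c w \<odot>\<^bsub>H\<^esub> T w)" for c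
    unfolding comb_def
    by (intro H.finsum_cong') (auto simp: e_def T_normalized_def H_smult_smult)
  have "e c \<in> carrier W \<rightarrow>\<^sub>E UNIV" "e d \<in> carrier W \<rightarrow>\<^sub>E UNIV"
    by (simp_all add: e_def)
  then have "e c = e d"
    using T_basis[OF comb_closed[of c]] e[of c] e[of d] eq by metis
  then have "e c w = e d w"
    by simp
  then show ?thesis
    using w assms(1) by (simp add: e_def del: of_real_divide of_real_power)
qed

lemma comb_indicator:
  assumes "x \<in> carrier W"
  shows "comb (\<lambda>w. if w = x then 1 else 0) = Tn x"
proof -
  have "comb (\<lambda>w. if w = x then 1 else 0) =
      (\<Oplus>\<^bsub>H\<^esub>w\<in>carrier W. if x = w then Tn w else \<zero>\<^bsub>H\<^esub>)"
    unfolding comb_def by (intro H.finsum_cong') auto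
  then show ?thesis
    using H.finsum_singleton[of x "carrier W" Tn] assms finite_W by auto
qed

text \<open>
  The rules for ascent and descent together say that \<open>Tn w\<close> is sent to \<open>Tn (w s)\<close> with
  the acceptance probability plus \<open>Tn w\<close> with the rejection probability. Collecting the coefficient
  of a fixed basis element requires the substitution of \<open>w s\<close> for \<open>w\<close> in the accepted part.
\<close>

lemma comb_mult_simple:
  assumes q: "q \<noteq> 0" and s: "s \<in> S"
  shows "comb c \<otimes>\<^bsub>H\<^esub> Tn s = comb (metropolis_step q s c)"
proof -
  \<comment> \<open>Acceptance and rejection probability of the proposal to move from \<open>w\<close> to \<open>w s\<close>.\<close>
  define \<alpha> where "\<alpha> w = (if len w < len (w \<otimes>\<^bsub>W\<^esub> s) then 1 else 1 / q)" for w
  define \<beta> where "\<beta> w = (if len w < len (w \<otimes>\<^bsub>W\<^esub> s) then 0 else 1 - 1 / q)" for w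
  have mult_Tn: "complex_of_real a \<odot>\<^bsub>H\<^esub> Tn w \<otimes>\<^bsub>H\<^esub> Tn s =
      complex_of_real (a * \<alpha> w) \<odot>\<^bsub>H\<^esub> Tn (w \<otimes>\<^bsub>W\<^esub> s) \<oplus>\<^bsub>H\<^esub> complex_of_real (a * \<beta> w) \<odot>\<^bsub>H\<^esub> Tn w"
    if w: "w \<in> carrier W" for w a
    using w s
  proof (cases rule: len_mult_simple_cases)
    case ascent
    then show ?thesis
      using w s by (simp add: \<alpha>_def \<beta>_def Tn_mult_ascent smult_mult_left)
  next
    case descent
    then show ?thesis
      using w s q
      by (simp add: \<alpha>_def \<beta>_def Tn_mult_descent smult_mult_left H_smult_distrib H_smult_smult
          of_real_mult [symmetric] del: of_real_diff of_real_divide of_real_mult)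
  qed
  have bij: "bij_betw (\<lambda>w. w \<otimes>\<^bsub>W\<^esub> s) (carrier W) (carrier W)"
    by (rule bij_betw_mult_simple[OF s])
  have "comb c \<otimes>\<^bsub>H\<^esub> Tn s =
      (\<Oplus>\<^bsub>H\<^esub>w\<in>carrier W. complex_of_real (c w) \<odot>\<^bsub>H\<^esub> Tn w \<otimes>\<^bsub>H\<^esub> Tn s)"
    unfolding comb_def using s by (intro H.finsum_ldistr finite_W) auto
  also have "\<dots> = (\<Oplus>\<^bsub>H\<^esub>w\<in>carrier W.
      complex_of_real (c w * \<alpha> w) \<odot>\<^bsub>H\<^esub> Tn (w \<otimes>\<^bsub>W\<^esub> s)
      \<oplus>\<^bsub>H\<^esub> complex_of_real (c w * \<beta> w) \<odot>\<^bsub>H\<^esub> Tn w)"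
    using s by (intro H.finsum_cong' mult_Tn) auto
  also have "\<dots> = (\<Oplus>\<^bsub>H\<^esub>w\<in>carrier W. complex_of_real (c w * \<alpha> w) \<odot>\<^bsub>H\<^esub> Tn (w \<otimes>\<^bsub>W\<^esub> s))
      \<oplus>\<^bsub>H\<^esub> comb (\<lambda>w. c w * \<beta> w)"
    unfolding comb_def using s by (intro H.finsum_addf) auto
  also have "(\<Oplus>\<^bsub>H\<^esub>w\<in>carrier W. complex_of_real (c w * \<alpha> w) \<odot>\<^bsub>H\<^esub> Tn (w \<otimes>\<^bsub>W\<^esub> s)) =
      comb (\<lambda>w. c (w \<otimes>\<^bsub>W\<^esub> s) * \<alpha> (w \<otimes>\<^bsub>W\<^esub> s))"
  proof -
    let ?f = "\<lambda>w. complex_of_real (c (w \<otimes>\<^bsub>W\<^esub> s) * \<alpha> (w \<otimes>\<^bsub>W\<^esub> s)) \<odot>\<^bsub>H\<^esub> Tn w"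
    have "(\<Oplus>\<^bsub>H\<^esub>w\<in>(\<lambda>w. w \<otimes>\<^bsub>W\<^esub> s) ` carrier W. ?f w) = (\<Oplus>\<^bsub>H\<^esub>w\<in>carrier W. ?f (w \<otimes>\<^bsub>W\<^esub> s))"
      using bij s by (intro H.finsum_reindex) (auto simp: bij_betw_def)
    also have "\<dots> = (\<Oplus>\<^bsub>H\<^esub>w\<in>carrier W. complex_of_real (c w * \<alpha> w) \<odot>\<^bsub>H\<^esub> Tn (w \<otimes>\<^bsub>W\<^esub> s))"
      using s by (intro H.finsum_cong') auto
    finally show ?thesis
      using bij by (simp add: comb_def bij_betw_def)
  qed
  also have "\<dots> \<oplus>\<^bsub>H\<^esub> comb (\<lambda>w. c w * \<beta> w) =
      comb (\<lambda>w. c (w \<otimes>\<^bsub>W\<^esub> s) * \<alpha> (w \<otimes>\<^bsub>W\<^esub> s) + c w * \<beta> w)"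
    by (rule comb_add [symmetric])
  also have "\<dots> = comb (metropolis_step q s c)"
  proof (rule comb_cong)
    fix w assume w: "w \<in> carrier W"
    from w s show "c (w \<otimes>\<^bsub>W\<^esub> s) * \<alpha> (w \<otimes>\<^bsub>W\<^esub> s) + c w * \<beta> w = metropolis_step q s c w"
      by (cases rule: len_mult_simple_cases)
        (use w s in \<open>simp_all add: \<alpha>_def \<beta>_def metropolis_step_def\<close>)
  qed
  finally show ?thesis .
qed

section \<open>Laws of the chain\<close>

lemma law_after_support:
  assumes "markov_chain_on (carrier W) K" "x \<in> carrier W"
  shows "set_pmf (law_after K x t) \<subseteq> carrier W"
  using assms by (induction t) (auto simp: law_after_def markov_chain_on_def)

text \<open>
  Linearity extends the defining property of the chain from point masses to all laws: a step of the
  chain is left multiplication by \<open>h\<close>.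
\<close>

lemma left_mult_comb_pmf:
  assumes h: "h \<in> carrier H" and K: "given_by_left_mult W S H q T K h"
    and \<nu>: "set_pmf \<nu> \<subseteq> carrier W"
  shows "h \<otimes>\<^bsub>H\<^esub> comb (pmf \<nu>) = comb (pmf (bind_pmf \<nu> K))"
proof -
  have K': "h \<otimes>\<^bsub>H\<^esub> Tn x = comb (pmf (K x))" if "x \<in> carrier W" for x
    using K that by (simp add: given_by_left_mult_def comb_def)
  have "h \<otimes>\<^bsub>H\<^esub> comb (pmf \<nu>) =
      (\<Oplus>\<^bsub>H\<^esub>x\<in>carrier W. h \<otimes>\<^bsub>H\<^esub> (complex_of_real (pmf \<nu> x) \<odot>\<^bsub>H\<^esub> Tn x))"
    unfolding comb_def using h by (intro H.finsum_rdistr finite_W) auto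
  also have "\<dots> = (\<Oplus>\<^bsub>H\<^esub>x\<in>carrier W. comb (\<lambda>y. pmf \<nu> x * pmf (K x) y))"
    using h by (intro H.finsum_cong') (auto simp: smult_mult_right K' comb_scale)
  also have "\<dots> = comb (\<lambda>y. \<Sum>x\<in>carrier W. pmf \<nu> x * pmf (K x) y)"
    by (rule comb_sum[OF finite_W, symmetric])
  also have "(\<lambda>y. \<Sum>x\<in>carrier W. pmf \<nu> x * pmf (K x) y) = pmf (bind_pmf \<nu> K)"
  proof
    fix y
    show "(\<Sum>x\<in>carrier W. pmf \<nu> x * pmf (K x) y) = pmf (bind_pmf \<nu> K) y"
      using \<nu> unfolding pmf_bind by (subst integral_measure_pmf[OF finite_W]) auto
  qed
  finally show ?thesis .
qed

text \<open>
  Both sides evolve in time by left multiplication with \<open>h\<close>, which commutes with the right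
  multiplication by associativity. So only time zero matters, where the equation is the ascent rule.
\<close>

lemma comb_law_after_mult_simple:
  assumes K: "markov_chain_on (carrier W) K" "h \<in> carrier H" "given_by_left_mult W S H q T K h"
    and x: "x \<in> carrier W" and s: "s \<in> S" and ascent: "len (x \<otimes>\<^bsub>W\<^esub> s) = Suc (len x)"
  shows "comb (pmf (law_after K (x \<otimes>\<^bsub>W\<^esub> s) t)) = comb (pmf (law_after K x t)) \<otimes>\<^bsub>H\<^esub> Tn s"
proof (induction t)
  case 0
  have "comb (pmf (return_pmf y)) = Tn y" if "y \<in> carrier W" for y
  proof -
    have "comb (pmf (return_pmf y)) = comb (\<lambda>w. if w = y then 1 else 0)"
      by (rule comb_cong) (simp add: indicator_def)
    then show ?thesis
      using comb_indicator[OF that] by simp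
  qed
  then show ?case
    using x s ascent by (simp add: law_after_def Tn_mult_ascent del: pmf_return)
next
  case (Suc t)
  have step: "comb (pmf (law_after K y (Suc t))) = h \<otimes>\<^bsub>H\<^esub> comb (pmf (law_after K y t))"
    if "y \<in> carrier W" for y
    using left_mult_comb_pmf[OF K(2,3) law_after_support[OF K(1) that]]
    by (simp add: law_after_def)
  show ?case
    using Suc x s K(2) by (simp add: step H.m_assoc)
qed

lemma law_after_mult_simple:
  assumes "q \<noteq> 0"
    and K: "markov_chain_on (carrier W) K" "h \<in> carrier H" "given_by_left_mult W S H q T K h"
    and x: "x \<in> carrier W" and s: "s \<in> S" and ascent: "len (x \<otimes>\<^bsub>W\<^esub> s) = Suc (len x)"
    and y: "y \<in> carrier W"
  shows "pmf (law_after K (x \<otimes>\<^bsub>W\<^esub> s) t) y = metropolis_step q s (pmf (law_after K x t)) y"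
proof (rule comb_inj[OF assms(1) _ y])
  show "comb (pmf (law_after K (x \<otimes>\<^bsub>W\<^esub> s) t)) = comb (metropolis_step q s (pmf (law_after K x t)))"
    using comb_law_after_mult_simple[OF K x s ascent] comb_mult_simple[OF assms(1) s] by simp
qed

text \<open>
  Each letter of a reduced word for \<open>x\<close> applies one more contraction to the law started at the
  identity.
\<close>

lemma l2_distance_law_after_le_one:
  assumes q: "q > 1"
    and K: "markov_chain_on (carrier W) K" "h \<in> carrier H" "given_by_left_mult W S H q T K h"
    and x: "x \<in> carrier W"
  shows "(l2_distance W S q (law_after K x t))\<^sup>2 \<le> (l2_distance W S q (law_after K \<one>\<^bsub>W\<^esub> t))\<^sup>2"
  using x
proof (induction "len x" arbitrary: x)
  case 0
  then show ?case
    using len_eq_0D by force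
next
  case (Suc n)
  obtain s v where sv: "s \<in> S" "v \<in> carrier W" "x = v \<otimes>\<^bsub>W\<^esub> s" "len v = n"
    using right_descent_exists Suc by metis
  have "weighted_square_sum q (pmf (law_after K x t)) =
      weighted_square_sum q (metropolis_step q s (pmf (law_after K v t)))"
    unfolding weighted_square_sum_def using law_after_mult_simple[OF _ K, of v s] sv q Suc
    by (intro sum.cong) auto
  also have "\<dots> \<le> weighted_square_sum q (pmf (law_after K v t))"
    using q sv by (intro metropolis_step_contraction)
  finally have "(l2_distance W S q (law_after K x t))\<^sup>2 \<le> (l2_distance W S q (law_after K v t))\<^sup>2"
    using q sv Suc finite_W law_after_support[OF K(1)]
    by (simp add: l2_distance_square mult_left_mono sum_nonneg)
  also have "\<dots> \<le> (l2_distance W S q (law_after K \<one>\<^bsub>W\<^esub> t))\<^sup>2"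
    using Suc sv by simp
  finally show ?case .
qed

end

lemma l2_distance_nonneg: "q \<ge> 0 \<Longrightarrow> l2_distance W S q \<nu> \<ge> 0"
  unfolding l2_distance_def weighted_l2_norm_def stationary_def
  by (intro real_sqrt_ge_zero sum_nonneg mult_nonneg_nonneg divide_nonneg_nonneg) auto

section \<open>The identity is the worst starting state\<close>

theorem theorem1p3:
  fixes W :: "('w, 'b) monoid_scheme" and S :: "'w set"
    and H :: "(complex, 'h) module" and T :: "'w \<Rightarrow> 'h" and q :: real
    and K :: "'w \<Rightarrow> 'w pmf" and h :: 'h
  assumes "q > 1"
    and "coxeter_system W S" and "finite (carrier W)"
    and "iwahori_hecke_algebra W S H q T"
    and "h \<in> carrier H"
    and "markov_chain_on (carrier W) K"
    and "given_by_left_mult W S H q T K h"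
    and "reversible_on (carrier W) (stationary W S q) K"
  shows "(\<forall>t::nat.
        (MAX x\<in>carrier W. (l2_distance W S q (law_after K x t))\<^sup>2)
          = (l2_distance W S q (law_after K \<one>\<^bsub>W\<^esub> t))\<^sup>2)
    \<and> (\<forall>(t::nat) (B::real). l2_distance W S q (law_after K \<one>\<^bsub>W\<^esub> t) \<le> B \<longrightarrow>
        (\<forall>x\<in>carrier W. l2_distance W S q (law_after K x t) \<le> B))"
proof -
  interpret iwahori_hecke_algebra W S H q T by fact
  have le: "(l2_distance W S q (law_after K x t))\<^sup>2 \<le> (l2_distance W S q (law_after K \<one>\<^bsub>W\<^esub> t))\<^sup>2"
    if "x \<in> carrier W" for x t
    using l2_distance_law_after_le_one assms that by blast
  show ?thesis
  proof (intro conjI allI impI ballI)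
    fix t
    show "(MAX x\<in>carrier W. (l2_distance W S q (law_after K x t))\<^sup>2)
        = (l2_distance W S q (law_after K \<one>\<^bsub>W\<^esub> t))\<^sup>2"
      using finite_W le by (intro Max_eqI) auto
  next
    fix t B x
    assume B: "l2_distance W S q (law_after K \<one>\<^bsub>W\<^esub> t) \<le> B" and x: "x \<in> carrier W"
    have "l2_distance W S q (law_after K x t) \<le> l2_distance W S q (law_after K \<one>\<^bsub>W\<^esub> t)"
      using le[OF x] by (rule power2_le_imp_le) (use assms(1) in \<open>simp add: l2_distance_nonneg\<close>)
    then show "l2_distance W S q (law_after K x t) \<le> B"
      using B by simp
  qed
qed

end
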